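(* For every 3-manifold triangulation given as input, the tree traversal algorithm (described in the context) is correct. That is, its output is precisely the set of all admissible vertices of the projective solution space $\mathscr{Q}$ of the triangulation.
   Context: **Triangulations.** A 3-manifold triangulation of size $n$ is a collection of $n$ tetrahedra, some or all of whose $4n$ faces are affinely identified in pairs so that the resulting topological space is a 3-manifold (possibly with boundary). Two faces of the same tetrahedron may be identified, and different edges or vertices of the same tetrahedron may become identified. **Matching equations.** Each tetrahedron with vertices $a,b,c,d$ has three quadrilateral types, corresponding to the three splittings $ab|cd$, $ac|bd$, $ad|bc$ of its vertices into two pairs. The coordinates $x_{3i-2},x_{3i-1},x_{3i}$ of $\mathbf{x}\in\mathbb{R}^{3n}$ correspond (in some fixed order) to the three quadrilateral types of the $i$th tetrahedron. For each edge $E$ of the triangulation (i.e. each class of identified tetrahedron edges) not lying in the boundary, fix an orientation of $E$ and a direction of travel around $E$. The tetrahedron corners around $E$ form a cycle; at each corner there is a tetrahedron with an edge $ab$ representing $E$ (oriented from $a$ to $b$), passed through from its face $abc$ to its face $abd$. This corner contributes $x_{ac|bd}-x_{ad|bc}$ (the coordinates being those of that tetrahedron). The matching equation of $E$ says that the sum of the contributions of all corners around $E$ is zero (a tetrahedron contributes once for each of its edges identified with $E$). $M$ is the integer coefficient matrix of these equations, with $3n$ columns and one row for each edge not in the boundary. **Projective solution space.** $\mathscr{Q}^\vee=\{\mathbf{x}\in\mathbb{R}^{3n}: \mathbf{x}\ge\mathbf{0},\ M\mathbf{x}=\mathbf{0}\}$ and $\mathscr{Q}=\{\mathbf{x}\in\mathscr{Q}^\vee:\sum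 x_i=1\}$, a polytope. A vector $\mathbf{x}\in\mathbb{R}^{3n}$ satisfies the quadrilateral constraints if for each $i=1,\dots,n$ at most one of $x_{3i-2},x_{3i-1},x_{3i}$ is non-zero. A vector is admissible if $\mathbf{x}\ge\mathbf{0}$, $M\mathbf{x}=\mathbf{0}$ and it satisfies the quadrilateral constraints. **Type vectors.** For $\mathbf{x}$ satisfying the quadrilateral constraints, its type vector $\tau(\mathbf{x})\in\{0,1,2,3\}^n$ has $i$th entry $0$ if $x_{3i-2}=x_{3i-1}=x_{3i}=0$, and $1$, $2$ or $3$ if the unique non-zero coordinate among these three is $x_{3i-2}$, $x_{3i-1}$ or $x_{3i}$ respectively. For $\tau,\sigma\in\{0,1,2,3\}^n$, $\tau$ dominates $\sigma$ if for each $i$ either $\sigma_i=\tau_i$ or $\sigma_i=0$. A partial type vector is an element $\tau$ of $\{0,1,2,3,-\}^n$, where $-$ is the "unknown symbol"; it is complete if it contains no $-$. The type constraints for $\tau$ on a point $\mathbf{x}\in\mathbb{R}^{3n}$ are, for each $i$: if $\tau_i=0$, $x_{3i-2}=x_{3i-1}=x_{3i}=0$; if $\tau_i=j\in\{1,2,3\}$, then $x_{3i-3+j}\ge 1$ and the other two of $x_{3i-2},x_{3i-1},x_{3i}$ are $0$; if $\tau_i=-$, no constraint. **Type tree.** The type tree is the rooted tree of height $n$ in which all leaves are at depth $n$ and every non-leaf node has exactly four children along edges labelled $0,1,2,3$. The root is labelled $(-,\dots,-)$; the child along edge $j$ of a depth-$i$ node labelled $(\tau_1,\dots,\tau_i,-,\dots,-)$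 is labelled $(\tau_1,\dots,\tau_i,j,-,\dots,-)$. **Tree traversal algorithm.** Construct $M$ and delete rows until it has full rank. Initialise an empty set $V$. Beginning at the root of the type tree, process nodes recursively (depth-first) as follows. - To process a non-leaf node, examine its four children in turn, beginning with the child along edge $0$ (the order of the other children is unimportant). For a child labelled $\tau$, recursively process this child if and only if all of the following hold: (a) zero test: $\tau$ is not the zero vector; (b) domination test: after replacing every unknown symbol in $\tau$ with $0$, the result does not dominate any type vector in the current set $V$; (c) feasibility test: there is some $\mathbf{x}\in\mathbb{R}^{3n}$ satisfying $\mathbf{x}\ge\mathbf{0}$, $M\mathbf{x}=\mathbf{0}$ and the type constraints for $\tau$. - To process a leaf node, labelled by a complete type vector $\tau$, insert $\tau$ into $V$, and reconstruct and output the vertex $\mathbf{x}$ of $\mathscr{Q}$ with type vector $\tau$ by solving simultaneously $M\mathbf{x}=\mathbf{0}$, $\sum x_i=1$, and the equations $x_j=0$ for all coordinates that $\tau$ dictates to be zero. *)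

theory Defs
  imports "HOL-Analysis.Analysis"
begin

section \<open>Triangulations\<close>

text \<open>
  The \<open>n\<close> tetrahedra are the elements of a finite type \<open>'t\<close>, so \<open>n = CARD('t) \<ge> 1\<close>.
  The vertices of every tetrahedron are named by the four-element type \<^typ>\<open>4\<close>; the pair
  \<open>(t, f)\<close> names the face of \<open>t\<close> opposite the vertex \<open>f\<close>. If \<open>G (t, f) = Some (t', q)\<close> then
  this face is identified with a face of \<open>t'\<close> by the affine map sending each vertex
  \<open>v \<noteq> f\<close> to \<open>q v\<close>. Extending \<open>q\<close> to a permutation of all four vertices (in the only possible
  way) makes \<open>q f\<close> the vertex opposite the target face. \<open>None\<close> marks a boundary face.
\<close>

type_synonym 't gluing = "'t \<times> 4 \<Rightarrow> ('t \<times> (4 \<Rightarrow> 4)) option"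

definition faces_paired :: "'t gluing \<Rightarrow> bool" where
  "faces_paired G \<longleftrightarrow>
     (\<forall>t f t' q. G (t, f) = Some (t', q) \<longrightarrow>
        bij q \<and> (t', q f) \<noteq> (t, f) \<and> G (t', q f) = Some (t, inv q))"

text \<open>A tetrahedron is the standard 3-simplex, in barycentric coordinates.\<close>

definition tetrahedron :: "(real^4) set" where
  "tetrahedron = {x. (\<forall>v. 0 \<le> x $ v) \<and> (\<Sum>v\<in>UNIV. x $ v) = 1}"

definition disjoint_tetrahedra :: "('t \<times> (real^4)) topology" where
  "disjoint_tetrahedra = prod_topology (discrete_topology UNIV) (top_of_set tetrahedron)"

definition face_identification :: "'t gluing \<Rightarrow> (('t \<times> (real^4)) \<times> ('t \<times> (real^4))) set" where
  "face_identification G =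
     {((t, x), (t', y)) | t x t' y. \<exists>f q. G (t, f) = Some (t', q) \<and>
        x \<in> tetrahedron \<and> x $ f = 0 \<and> (\<forall>v. y $ q v = x $ v)}"

text \<open>
  Under \<^const>\<open>faces_paired\<close> the relation \<^const>\<open>face_identification\<close> is symmetric, so its
  reflexive transitive closure is the equivalence relation it generates.
\<close>

definition point_class :: "'t gluing \<Rightarrow> 't \<times> (real^4) \<Rightarrow> ('t \<times> (real^4)) set" where
  "point_class G p = (face_identification G)\<^sup>* `` {p}"

definition triangulated_space :: "'t gluing \<Rightarrow> ('t \<times> (real^4)) set topology" where
  "triangulated_space G = topology (\<lambda>U.
     U \<subseteq> point_class G ` topspace disjoint_tetrahedra \<and>
     openin disjoint_tetrahedra {p \<in> topspace disjoint_tetrahedra. point_class G p \<in> U})"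

lemma openin_triangulated_space:
  fixes G :: "'t gluing"
  shows "openin (triangulated_space G) U \<longleftrightarrow>
     U \<subseteq> point_class G ` topspace disjoint_tetrahedra \<and>
     openin disjoint_tetrahedra {p \<in> topspace disjoint_tetrahedra. point_class G p \<in> U}"
proof -
  define X where "X = (disjoint_tetrahedra :: ('t \<times> (real^4)) topology)"
  define f where "f = point_class G"
  have "istopology (\<lambda>U. U \<subseteq> f ` topspace X \<and> openin X {p \<in> topspace X. f p \<in> U})"
    unfolding istopology_def
  proof (intro conjI allI impI)
    fix S T
    assume S: "S \<subseteq> f ` topspace X \<and> openin X {p \<in> topspace X. f p \<in> S}"
      and T: "T \<subseteq> f ` topspace X \<and> openin X {p \<in> topspace X. f p \<in> T}"
    have "{p \<in> topspace X. f p \<in> S \<inter> T} =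
        {p \<in> topspace X. f p \<in> S} \<inter> {p \<in> topspace X. f p \<in> T}"
      by blast
    with S T show "openin X {p \<in> topspace X. f p \<in> S \<inter> T}"
      by (simp only: openin_Int)
    from S show "S \<inter> T \<subseteq> f ` topspace X" by blast
  next
    fix \<K>
    assume *: "\<forall>K\<in>\<K>. K \<subseteq> f ` topspace X \<and> openin X {p \<in> topspace X. f p \<in> K}"
    then show "\<Union>\<K> \<subseteq> f ` topspace X" by blast
    have "{p \<in> topspace X. f p \<in> \<Union>\<K>} = \<Union> ((\<lambda>K. {p \<in> topspace X. f p \<in> K}) ` \<K>)"
      by blast
    moreover have "openin X (\<Union> ((\<lambda>K. {p \<in> topspace X. f p \<in> K}) ` \<K>))"
      using * by (intro openin_Union) blast
    ultimately show "openin X {p \<in> topspace X. f p \<in> \<Union>\<K>}" by (simp only:)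
  qed
  from topology_inverse'[OF this] show ?thesis
    by (simp only: triangulated_space_def X_def f_def)
qed

lemma quotient_map_triangulated_space:
  fixes G :: "'t gluing"
  shows "quotient_map disjoint_tetrahedra (triangulated_space G) (point_class G)"
proof -
  define X where "X = (disjoint_tetrahedra :: ('t \<times> (real^4)) topology)"
  define Y where "Y = triangulated_space G"
  define f where "f = point_class G"
  have op: "openin Y U \<longleftrightarrow> U \<subseteq> f ` topspace X \<and> openin X {p \<in> topspace X. f p \<in> U}" for U
    unfolding X_def Y_def f_def by (rule openin_triangulated_space)
  have "{p \<in> topspace X. f p \<in> f ` topspace X} = topspace X"
    by blast
  then have "openin Y (f ` topspace X)"
    by (simp only: op openin_topspace subset_refl)
  moreover have "topspace Y \<subseteq> f ` topspace X"
    using op[of "topspace Y"] openin_topspace[of Y] by blast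
  ultimately have "topspace Y = f ` topspace X"
    using openin_subset by blast
  then show ?thesis
    unfolding quotient_map_def X_def[symmetric] Y_def[symmetric] f_def[symmetric]
    using op by presburger
qed

text \<open>Points of a 3-manifold with (possibly empty) boundary are modelled on the half-space.\<close>

definition three_manifold :: "'a topology \<Rightarrow> bool" where
  "three_manifold X \<longleftrightarrow> Hausdorff_space X \<and> second_countable X \<and>
     (\<forall>p \<in> topspace X. \<exists>U V. openin X U \<and> p \<in> U \<and>
        openin (top_of_set {x :: real^3. 0 \<le> x $ 1}) V \<and>
        subtopology X U homeomorphic_space top_of_set V)"

definition three_manifold_triangulation :: "'t::finite gluing \<Rightarrow> bool" where
  "three_manifold_triangulation G \<longleftrightarrow>
     faces_paired G \<and> three_manifold (triangulated_space G)"


section \<open>Matching equations\<close>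

text \<open>
  An edge of a tetrahedron is \<open>(t, {a, b})\<close> with \<open>a \<noteq> b\<close>; it is an edge of the face \<open>(t, f)\<close>
  iff \<open>f \<notin> {a, b}\<close>.
\<close>

definition tet_edges :: "('t \<times> 4 set) set" where
  "tet_edges = {(t, e). card e = 2}"

definition edge_identification :: "'t gluing \<Rightarrow> (('t \<times> 4 set) \<times> ('t \<times> 4 set)) set" where
  "edge_identification G =
     {((t, e), (t', q ` e)) | t e t' q. \<exists>f. f \<notin> e \<and> G (t, f) = Some (t', q)}"

definition edges :: "'t gluing \<Rightarrow> ('t \<times> 4 set) set set" where
  "edges G = tet_edges // (edge_identification G)\<^sup>*"

definition boundary_edge :: "'t gluing \<Rightarrow> ('t \<times> 4 set) set \<Rightarrow> bool" where
  "boundary_edge G E \<longleftrightarrow> (\<exists>(t, e) \<in> E. \<exists>f. f \<notin> e \<and> G (t, f) = None)"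

definition interior_edges :: "'t gluing \<Rightarrow> ('t \<times> 4 set) set set" where
  "interior_edges G = {E \<in> edges G. \<not> boundary_edge G E}"

text \<open>
  The corner \<open>(t, a, b, c, d)\<close> is the tetrahedron \<open>t\<close> at its edge \<open>ab\<close>, oriented from \<open>a\<close> to \<open>b\<close>
  and passed through from the face \<open>abc\<close> to the face \<open>abd\<close>. The exit face \<open>abd\<close> is opposite
  \<open>c\<close>; if it is glued by \<open>q\<close>, then the next tetrahedron is entered through the face opposite
  \<open>q c\<close> and left through the face opposite \<open>q d\<close>.
\<close>

type_synonym 't corner = "'t \<times> 4 \<times> 4 \<times> 4 \<times> 4"

definition corner_step :: "'t gluing \<Rightarrow> ('t corner \<times> 't corner) set" where
  "corner_step G =
     {((t, a, b, c, d), (t', q a, q b, q d, q c)) | t a b c d t' q. G (t, c) = Some (t', q)}"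

definition corner_cycle :: "'t gluing \<Rightarrow> 't corner \<Rightarrow> 't corner set" where
  "corner_cycle G k = (corner_step G)\<^sup>* `` {k}"

text \<open>
  A corner of \<open>E\<close> fixes an orientation of \<open>E\<close> and a direction of travel around \<open>E\<close>, and every
  such choice arises from some corner.
\<close>

fun is_corner_of :: "'t corner \<Rightarrow> ('t \<times> 4 set) set \<Rightarrow> bool" where
  "is_corner_of (t, a, b, c, d) E \<longleftrightarrow> distinct [a, b, c, d] \<and> (t, {a, b}) \<in> E"

definition splitting :: "4 \<Rightarrow> 4 \<Rightarrow> 4 \<Rightarrow> 4 \<Rightarrow> 4 set set" where
  "splitting a b c d = {{a, b}, {c, d}}"

definition quad_types :: "4 set set set" where
  "quad_types = {splitting a b c d | a b c d. distinct [a, b, c, d]}"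

text \<open>
  Vectors of \<open>\<real>\<^sup>3\<^sup>n\<close> have type \<^typ>\<open>real^3^'t\<close>: if \<open>t\<close> is the \<open>i\<close>th tetrahedron then
  \<open>x $ t $ 1\<close>, \<open>x $ t $ 2\<close>, \<open>x $ t $ 3\<close> are the coordinates numbered \<open>3i-2\<close>, \<open>3i-1\<close>, \<open>3i\<close>.
  The order of the three quadrilateral types of \<open>t\<close> is a bijection \<open>quad t\<close> from
  \<^const>\<open>quad_types\<close> to \<^typ>\<open>3\<close>.
\<close>

fun contribution :: "('t \<Rightarrow> 4 set set \<Rightarrow> 3) \<Rightarrow> 't::finite corner \<Rightarrow> real^3^'t" where
  "contribution quad (t, a, b, c, d) =
     axis t (axis (quad t (splitting a c b d)) 1 - axis (quad t (splitting a d b c)) 1)"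

text \<open>
  The matrix \<open>M\<close> is the family of its rows, indexed by \<^term>\<open>interior_edges G\<close>; \<open>start E\<close> is the
  corner at which the trip around \<open>E\<close> starts. In a 3-manifold triangulation the set
  \<^term>\<open>corner_cycle G (start E)\<close> has exactly one corner at each tetrahedron edge in \<open>E\<close>.
\<close>

definition matching_matrix ::
    "'t::finite gluing \<Rightarrow> ('t \<Rightarrow> 4 set set \<Rightarrow> 3) \<Rightarrow> (('t \<times> 4 set) set \<Rightarrow> 't corner)
      \<Rightarrow> ('t \<times> 4 set) set \<Rightarrow> real^3^'t" where
  "matching_matrix G quad start E = (\<Sum>k \<in> corner_cycle G (start E). contribution quad k)"


section \<open>Projective solution space\<close>

text \<open>In this section \<open>I\<close> is the set of row indices of the matrix \<open>M\<close>.\<close>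

definition solves :: "'e set \<Rightarrow> ('e \<Rightarrow> real^3^'t::finite) \<Rightarrow> real^3^'t \<Rightarrow> bool" where
  "solves I M x \<longleftrightarrow> (\<forall>E\<in>I. M E \<bullet> x = 0)"

definition nonneg :: "real^3^'t::finite \<Rightarrow> bool" where
  "nonneg x \<longleftrightarrow> (\<forall>t j. 0 \<le> x $ t $ j)"

definition coord_sum :: "real^3^'t::finite \<Rightarrow> real" where
  "coord_sum x = (\<Sum>t\<in>UNIV. \<Sum>j\<in>UNIV. x $ t $ j)"

definition solution_cone :: "'e set \<Rightarrow> ('e \<Rightarrow> real^3^'t::finite) \<Rightarrow> (real^3^'t) set" where
  "solution_cone I M = {x. nonneg x \<and> solves I M x}"

definition projective_solution_space ::
    "'e set \<Rightarrow> ('e \<Rightarrow> real^3^'t::finite) \<Rightarrow> (real^3^'t) set" where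
  "projective_solution_space I M = {x \<in> solution_cone I M. coord_sum x = 1}"

definition quad_constraints :: "real^3^'t::finite \<Rightarrow> bool" where
  "quad_constraints x \<longleftrightarrow> (\<forall>t. card {j. x $ t $ j \<noteq> 0} \<le> 1)"

definition admissible :: "'e set \<Rightarrow> ('e \<Rightarrow> real^3^'t::finite) \<Rightarrow> real^3^'t \<Rightarrow> bool" where
  "admissible I M x \<longleftrightarrow> nonneg x \<and> solves I M x \<and> quad_constraints x"


section \<open>Type vectors\<close>

text \<open>
  The entries \<open>0\<close>, \<open>j\<close> (for \<open>j = 1, 2, 3\<close>) and \<open>-\<close> of a partial type vector are written
  \<open>Zero\<close>, \<open>Quad j\<close> and \<open>Unknown\<close>.
\<close>

datatype type_entry = Zero | Quad "3" | Unknown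

type_synonym 't type_vector = "'t \<Rightarrow> type_entry"

definition dominates :: "'t type_vector \<Rightarrow> 't type_vector \<Rightarrow> bool" where
  "dominates \<tau> \<sigma> \<longleftrightarrow> (\<forall>t. \<sigma> t = \<tau> t \<or> \<sigma> t = Zero)"

definition unknown_to_zero :: "'t type_vector \<Rightarrow> 't type_vector" where
  "unknown_to_zero \<tau> = (\<lambda>t. if \<tau> t = Unknown then Zero else \<tau> t)"

text \<open>The coordinates that are dictated to be zero by an entry of a type vector.\<close>

fun dictated_zero :: "type_entry \<Rightarrow> 3 \<Rightarrow> bool" where
  "dictated_zero Zero k \<longleftrightarrow> True"
| "dictated_zero (Quad j) k \<longleftrightarrow> k \<noteq> j"
| "dictated_zero Unknown k \<longleftrightarrow> False"

definition type_constraints :: "'t type_vector \<Rightarrow> real^3^'t::finite \<Rightarrow> bool" where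
  "type_constraints \<tau> x \<longleftrightarrow>
     (\<forall>t k. dictated_zero (\<tau> t) k \<longrightarrow> x $ t $ k = 0) \<and>
     (\<forall>t j. \<tau> t = Quad j \<longrightarrow> 1 \<le> x $ t $ j)"


section \<open>The tree traversal algorithm\<close>

text \<open>
  \<open>K\<close> is a set of rows left after deleting redundant rows of \<open>M\<close> until it has full rank. All
  possible outcomes of that deletion are allowed. The row space, and hence the rank, must not
  change; the condition \<^const>\<open>inj_on\<close> is needed because \<open>M\<close> may have repeated rows.
\<close>

definition full_rank_rows :: "'e set \<Rightarrow> ('e \<Rightarrow> 'v::euclidean_space) \<Rightarrow> 'e set \<Rightarrow> bool" where
  "full_rank_rows I M K \<longleftrightarrow>
     K \<subseteq> I \<and> inj_on M K \<and> independent (M ` K) \<and> span (M ` K) = span (M ` I)"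

definition passes_tests ::
    "'e set \<Rightarrow> ('e \<Rightarrow> real^3^'t::finite) \<Rightarrow> 't type_vector set \<Rightarrow> 't type_vector \<Rightarrow> bool" where
  "passes_tests K M V \<tau> \<longleftrightarrow>
     \<tau> \<noteq> (\<lambda>t. Zero) \<and>
     \<not> (\<exists>\<sigma>\<in>V. dominates (unknown_to_zero \<tau>) \<sigma>) \<and>
     (\<exists>x. nonneg x \<and> solves K M x \<and> type_constraints \<tau> x)"

definition reconstruct ::
    "'e set \<Rightarrow> ('e \<Rightarrow> real^3^'t::finite) \<Rightarrow> 't type_vector \<Rightarrow> real^3^'t" where
  "reconstruct K M \<tau> = (THE x. solves K M x \<and> coord_sum x = 1 \<and>
     (\<forall>t k. dictated_zero (\<tau> t) k \<longrightarrow> x $ t $ k = 0))"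

text \<open>
  The state of the algorithm is the pair of the set \<open>V\<close> and the set of vectors output so far.
  A node of the type tree is given by its label \<open>\<tau>\<close> and the list of the tetrahedra whose entries
  are still unknown; it is a leaf iff this list is empty. Its children along the edges other
  than \<open>0\<close> are examined in the order \<open>ord \<tau>\<close>. No generality is lost by letting this order depend
  on the node only, because a run processes each node at most once.
\<close>

primrec process ::
    "'e set \<Rightarrow> ('e \<Rightarrow> real^3^'t::finite) \<Rightarrow> ('t type_vector \<Rightarrow> type_entry list) \<Rightarrow> 't list
      \<Rightarrow> 't type_vector \<Rightarrow> 't type_vector set \<times> (real^3^'t) set
      \<Rightarrow> 't type_vector set \<times> (real^3^'t) set" where
  "process K M ord [] \<tau> s = (insert \<tau> (fst s), insert (reconstruct K M \<tau>) (snd s))"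
| "process K M ord (t # ts) \<tau> s =
     fold (\<lambda>j s. if passes_tests K M (fst s) (\<tau>(t := j))
                 then process K M ord ts (\<tau>(t := j)) s else s)
          (Zero # ord \<tau>) s"

definition tree_traversal ::
    "'e set \<Rightarrow> ('e \<Rightarrow> real^3^'t::finite) \<Rightarrow> ('t type_vector \<Rightarrow> type_entry list) \<Rightarrow> 't list
      \<Rightarrow> (real^3^'t) set" where
  "tree_traversal K M ord ts = snd (process K M ord ts (\<lambda>t. Unknown) ({}, {}))"

end

theory Submission
  imports Defs
begin

text \<open>
  Call a complete type vector a vertex type if it is the type vector of an admissible vertex
  of \<open>\<Q>\<close>. The traversal is correct because at every moment \<open>V\<close> consists of vertex types, and at
  the end \<open>V\<close> contains all of them; the output is then the set of the corresponding vertices.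

  The geometry enters through supports. A vertex is the only solution of the matching equations
  with coordinate sum \<open>1\<close> whose support lies in its own support
  (\<open>extreme_point_unique_on_support\<close>): otherwise the vertex could be moved a little in both
  directions along a line inside \<open>\<Q>\<close>. Hence the reconstruction step recovers a vertex from its
  type, and no vertex type dominates another one. Conversely, the points of \<open>\<Q>\<close> whose support
  lies in a given set form a compact face, which has an extreme point; so every feasible
  non-zero complete type vector dominates some vertex type (\<open>feasible_dominates_vertex_type\<close>).

  These facts make the tests exact, provided that the nodes are visited in a suitable order. If a
  child fails a test, then every vertex type below it is already in \<open>V\<close>
  (\<open>rejected_child_has_no_new_vertex_type\<close>), so nothing is lost. If a leaf \<open>\<tau>\<close> passes the tests, it
  dominates a vertex type \<open>\<sigma>\<close>. Where \<open>\<sigma>\<close> first differs from \<open>\<tau>\<close>, it has the entry \<open>0\<close>, and the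
  child along the edge \<open>0\<close> is examined first; so if \<open>\<sigma> \<noteq> \<tau>\<close> then \<open>\<sigma>\<close> is in \<open>V\<close> already and the
  domination test would have failed. Hence \<open>\<tau> = \<sigma>\<close> is a vertex type.

  Finally, deleting rows of \<open>M\<close> without changing the row space does not change the solutions of
  \<open>M x = 0\<close>, so it changes neither \<open>\<Q>\<close> nor the notion of admissibility.
\<close>

section \<open>Supports and extreme points\<close>

text \<open>
  A small multiple of \<open>d\<close> can be added to or subtracted from \<open>x\<close> without leaving the non-negative
  orthant. The same bound, for a 0/1 vector \<open>d\<close>, says that a large multiple of \<open>x\<close> is at least \<open>1\<close>
  on its support.
\<close>

lemma support_le_imp_abs_le_scaled:
  fixes x d :: "real^3^'t::finite"
  assumes "nonneg x" and supp: "\<And>t k. x $ t $ k = 0 \<Longrightarrow> d $ t $ k = 0"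
  obtains c where "c > 0" and "\<And>t k. \<bar>d $ t $ k\<bar> \<le> c * x $ t $ k"
proof -
  have x0: "0 \<le> x $ t $ k" for t k
    using assms(1) by (simp add: nonneg_def)
  define S where "S = (\<Sum>t\<in>UNIV. \<Sum>k\<in>UNIV. \<bar>d $ t $ k\<bar> / x $ t $ k)"
  have inner: "0 \<le> (\<Sum>k\<in>UNIV. \<bar>d $ t $ k\<bar> / x $ t $ k)" for t
    by (intro sum_nonneg divide_nonneg_nonneg x0) simp
  have S0: "0 \<le> S"
    unfolding S_def by (intro sum_nonneg inner)
  have "\<bar>d $ t $ k\<bar> \<le> (1 + S) * x $ t $ k" for t k
  proof (cases "x $ t $ k = 0")
    case True
    then show ?thesis using supp by simp
  next
    case False
    have "\<bar>d $ t $ k\<bar> / x $ t $ k \<le> (\<Sum>k\<in>UNIV. \<bar>d $ t $ k\<bar> / x $ t $ k)"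
      by (rule member_le_sum[of k UNIV "\<lambda>k. \<bar>d $ t $ k\<bar> / x $ t $ k"]) (simp_all add: x0)
    also have "\<dots> \<le> S"
      unfolding S_def
      by (rule member_le_sum[of t UNIV "\<lambda>t. \<Sum>k\<in>UNIV. \<bar>d $ t $ k\<bar> / x $ t $ k"])
         (simp_all add: inner)
    also have "\<dots> \<le> 1 + S"
      by simp
    finally show ?thesis
      using False x0[of t k] by (simp add: pos_divide_le_eq)
  qed
  with S0 show ?thesis
    by (intro that[of "1 + S"]) auto
qed

lemma coord_sum_linear:
  fixes x y :: "real^3^'t::finite"
  shows "coord_sum (x + y) = coord_sum x + coord_sum y"
    and "coord_sum (x - y) = coord_sum x - coord_sum y"
    and "coord_sum (c *\<^sub>R x) = c * coord_sum x"
  by (simp_all add: coord_sum_def sum.distrib sum_subtractf sum_distrib_left)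

lemma solves_linear:
  assumes "solves I M x" and "solves I M y"
  shows "solves I M (x + y)" and "solves I M (x - y)" and "solves I M (c *\<^sub>R x)"
  using assms by (simp_all add: solves_def inner_add_right inner_diff_right)

lemma projective_solution_space_iff:
  "x \<in> projective_solution_space I M \<longleftrightarrow> nonneg x \<and> solves I M x \<and> coord_sum x = 1"
  by (auto simp: projective_solution_space_def solution_cone_def)

text \<open>
  Here \<open>z\<close> ranges over all solutions and not only over the points of \<open>\<Q>\<close>, because the
  reconstruction step solves equations without sign conditions. If \<open>z \<noteq> x\<close>, then \<open>x\<close> is the midpoint of two points
  of \<open>\<Q>\<close> on the line through \<open>x\<close> and \<open>z\<close>.
\<close>

lemma extreme_point_unique_on_support:
  fixes x z :: "real^3^'t::finite"
  assumes ext: "x extreme_point_of projective_solution_space I M"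
    and z: "solves I M z" "coord_sum z = 1"
    and supp: "\<And>t k. x $ t $ k = 0 \<Longrightarrow> z $ t $ k = 0"
  shows "z = x"
proof (rule ccontr)
  assume "z \<noteq> x"
  have x: "nonneg x" "solves I M x" "coord_sum x = 1"
    using ext by (auto simp: extreme_point_of_def projective_solution_space_iff)
  define d where "d = z - x"
  have d: "solves I M d" "coord_sum d = 0" "d \<noteq> 0"
    using z x \<open>z \<noteq> x\<close> by (simp_all add: d_def solves_linear coord_sum_linear)
  have "\<And>t k. x $ t $ k = 0 \<Longrightarrow> d $ t $ k = 0"
    using supp by (simp add: d_def)
  then obtain c where c: "c > 0" "\<And>t k. \<bar>d $ t $ k\<bar> \<le> c * x $ t $ k"
    using support_le_imp_abs_le_scaled x(1) by metis
  define e where "e = (1 / c) *\<^sub>R d"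
  have e: "solves I M e" "coord_sum e = 0" "e \<noteq> 0"
    using d c(1) by (simp_all add: e_def solves_linear coord_sum_linear)
  have "\<bar>e $ t $ k\<bar> \<le> x $ t $ k" for t k
    using c by (simp add: e_def abs_mult pos_divide_le_eq mult.commute)
  then have bound: "0 \<le> x $ t $ k + e $ t $ k" "0 \<le> x $ t $ k - e $ t $ k" for t k
    by (smt (verit))+
  have "x + e \<in> projective_solution_space I M" "x - e \<in> projective_solution_space I M"
    using x e bound
    by (simp_all add: projective_solution_space_iff solves_linear coord_sum_linear nonneg_def)
  moreover have "x \<in> open_segment (x + e) (x - e)"
  proof -
    have "x = midpoint (x + e) (x - e)"
      by (simp add: midpoint_def flip: scaleR_2)
    moreover have "x + e \<noteq> x - e"
      using e(3) by (simp add: eq_neg_iff_add_eq_0 flip: scaleR_2)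
    ultimately show ?thesis
      by (metis midpoint_in_open_segment)
  qed
  ultimately show False
    using ext by (auto simp: extreme_point_of_def)
qed

lemma convex_projective_solution_space: "convex (projective_solution_space I M)"
  by (rule convexI)
     (auto simp: projective_solution_space_iff nonneg_def coord_sum_linear
        intro!: solves_linear add_nonneg_nonneg mult_nonneg_nonneg)

lemma compact_projective_solution_space:
  fixes M :: "'e \<Rightarrow> real^3^'t::finite"
  shows "compact (projective_solution_space I M)"
proof -
  have "projective_solution_space I M =
      (\<Inter>t. \<Inter>k. {x. 0 \<le> x $ t $ k}) \<inter> (\<Inter>E\<in>I. {x. M E \<bullet> x = 0}) \<inter> {x. coord_sum x = 1}"
    by (auto simp: projective_solution_space_iff nonneg_def solves_def)
  also have "closed \<dots>"
    unfolding coord_sum_def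
    by (intro closed_Int closed_INT ballI closed_Collect_le closed_Collect_eq continuous_intros)
  finally have "closed (projective_solution_space I M)" .
  moreover have "norm x \<le> 1" if "x \<in> projective_solution_space I M" for x
  proof -
    have x: "\<And>t k. 0 \<le> x $ t $ k" "coord_sum x = 1"
      using that by (auto simp: projective_solution_space_iff nonneg_def)
    have "norm x \<le> (\<Sum>t\<in>UNIV. norm (x $ t))"
      by (simp add: norm_vec_def L2_set_le_sum)
    also have "\<dots> \<le> (\<Sum>t\<in>UNIV. \<Sum>k\<in>UNIV. \<bar>x $ t $ k\<bar>)"
      by (intro sum_mono norm_le_l1_cart)
    also have "\<dots> = 1"
      using x by (simp add: coord_sum_def)
    finally show ?thesis .
  qed
  then have "bounded (projective_solution_space I M)"
    by (rule boundedI)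
  ultimately show ?thesis
    by (simp add: compact_eq_bounded_closed)
qed

text \<open>
  The points of \<open>\<Q>\<close> with support in that of \<open>x\<close> form a face, whose extreme points are vertices
  of \<open>\<Q>\<close>.
\<close>

lemma extreme_point_in_support:
  fixes x :: "real^3^'t::finite"
  assumes x: "x \<in> projective_solution_space I M"
  obtains y where "y extreme_point_of projective_solution_space I M"
    and "\<And>t k. x $ t $ k = 0 \<Longrightarrow> y $ t $ k = 0"
proof -
  define Q where "Q = projective_solution_space I M"
  define Z :: "(real^3^'t) set" where "Z = {y. \<forall>t k. x $ t $ k = 0 \<longrightarrow> y $ t $ k = 0}"
  have Z_eq: "Z = (\<Inter>t. \<Inter>k\<in>{k. x $ t $ k = 0}. {y. y $ t $ k = 0})"
    by (auto simp: Z_def)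
  have "closed Z"
    unfolding Z_eq by (intro closed_INT ballI closed_Collect_eq continuous_intros)
  then have "compact (Q \<inter> Z)"
    using compact_projective_solution_space unfolding Q_def by (rule compact_Int_closed[rotated])
  moreover have "convex Z"
    by (rule convexI) (auto simp: Z_def)
  then have conv: "convex (Q \<inter> Z)"
    unfolding Q_def by (intro convex_Int convex_projective_solution_space)
  moreover have "Q \<inter> Z \<noteq> {}"
    using x by (auto simp: Q_def Z_def)
  ultimately obtain y where y: "y extreme_point_of (Q \<inter> Z)"
    using extreme_point_exists_convex by blast
  have "(Q \<inter> Z) face_of Q"
    unfolding face_of_def
  proof (intro conjI ballI impI)
    fix a b p
    assume ab: "a \<in> Q" "b \<in> Q" and p: "p \<in> Q \<inter> Z" and seg: "p \<in> open_segment a b"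
    have nn: "0 \<le> a $ t $ k" "0 \<le> b $ t $ k" for t k
      using ab by (auto simp: Q_def projective_solution_space_iff nonneg_def)
    obtain u where u: "0 < u" "u < 1" "p = (1 - u) *\<^sub>R a + u *\<^sub>R b"
      using seg by (auto simp: in_segment)
    \<comment> \<open>a convex combination of non-negative numbers vanishes only if both of them do\<close>
    have "a $ t $ k = 0 \<and> b $ t $ k = 0" if "x $ t $ k = 0" for t k
    proof -
      have "(1 - u) * a $ t $ k + u * b $ t $ k = 0"
        using p that u(3) by (auto simp: Z_def)
      moreover have "0 \<le> (1 - u) * a $ t $ k" "0 \<le> u * b $ t $ k"
        using nn u by simp_all
      ultimately show ?thesis
        using u by (simp add: add_nonneg_eq_0_iff)
    qed
    then show "a \<in> Q \<inter> Z" "b \<in> Q \<inter> Z"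
      using ab by (auto simp: Z_def)
  qed (use conv in auto)
  then have "y extreme_point_of Q" "y \<in> Z"
    using y extreme_point_of_face by blast+
  then show ?thesis
    using that by (auto simp: Q_def Z_def)
qed


section \<open>Vertex types\<close>

text \<open>
  This relation includes the quadrilateral constraints on \<open>x\<close>. An entry other than \<^const>\<open>Unknown\<close>
  is determined by the coordinates that it dictates to be zero, so comparing these with the zero
  coordinates of \<open>x\<close> avoids choosing a non-zero coordinate. It also turns domination into inclusion
  of supports.
\<close>

definition has_type :: "'t type_vector \<Rightarrow> real^3^'t::finite \<Rightarrow> bool" where
  "has_type \<tau> x \<longleftrightarrow>
     (\<forall>t. \<tau> t \<noteq> Unknown) \<and> (\<forall>t k. dictated_zero (\<tau> t) k \<longleftrightarrow> x $ t $ k = 0)"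

definition vertex_types :: "'e set \<Rightarrow> ('e \<Rightarrow> real^3^'t::finite) \<Rightarrow> 't type_vector set" where
  "vertex_types I M = {\<tau>. \<exists>x. x extreme_point_of projective_solution_space I M \<and> has_type \<tau> x}"

lemma dictated_zero_mono_iff:
  assumes "p \<noteq> Unknown" and "q \<noteq> Unknown"
  shows "(\<forall>k. dictated_zero p k \<longrightarrow> dictated_zero q k) \<longleftrightarrow> q = p \<or> q = Zero"
  using assms by (cases p; cases q) auto

lemma dominates_iff_support:
  assumes "has_type \<tau> x" and "has_type \<sigma> y"
  shows "dominates \<tau> \<sigma> \<longleftrightarrow> (\<forall>t k. x $ t $ k = 0 \<longrightarrow> y $ t $ k = 0)"
  using assms dictated_zero_mono_iff unfolding has_type_def dominates_def by metis

lemma dominates_antisym: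
  assumes "dominates \<tau> \<sigma>" and "dominates \<sigma> \<tau>"
  shows "\<tau> = \<sigma>"
  using assms unfolding dominates_def by (metis ext)

lemma has_type_unique: "has_type \<tau> x \<Longrightarrow> has_type \<sigma> x \<Longrightarrow> \<tau> = \<sigma>"
  by (rule dominates_antisym) (simp_all add: dominates_iff_support)

lemma quad_constraints_iff_has_type: "quad_constraints x \<longleftrightarrow> (\<exists>\<tau>. has_type \<tau> x)"
proof -
  have "card {j. x $ t $ j \<noteq> 0} \<le> 1 \<longleftrightarrow>
      (\<exists>p. p \<noteq> Unknown \<and> (\<forall>k. dictated_zero p k \<longleftrightarrow> x $ t $ k = 0))" (is "?L \<longleftrightarrow> ?R") for t
  proof
    assume ?L
    then consider "{j. x $ t $ j \<noteq> 0} = {}" | j where "{j. x $ t $ j \<noteq> 0} = {j}"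
      by (metis One_nat_def card_1_singletonE card_eq_0_iff finite le_SucE le_zero_eq)
    then show ?R
    proof cases
      case 1
      then show ?thesis by (intro exI[of _ Zero]) auto
    next
      case (2 j)
      then show ?thesis by (intro exI[of _ "Quad j"]) auto
    qed
  next
    assume ?R
    then obtain p where p: "p \<noteq> Unknown" "\<forall>k. dictated_zero p k \<longleftrightarrow> x $ t $ k = 0"
      by blast
    then have "{j. x $ t $ j \<noteq> 0} \<subseteq> (case p of Quad j \<Rightarrow> {j} | _ \<Rightarrow> {})"
      by (cases p) auto
    then show ?L
      using p(1) by (cases p) (auto dest: card_mono[rotated])
  qed
  then show ?thesis
    unfolding quad_constraints_def has_type_def by (simp add: choice_iff flip: all_conj_distrib)
qed

lemma type_constraints_imp_has_type:
  assumes "type_constraints \<tau> x" and "\<forall>t. \<tau> t \<noteq> Unknown"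
  shows "has_type \<tau> x"
proof -
  have "dictated_zero (\<tau> t) k \<longleftrightarrow> x $ t $ k = 0" for t k
    using assms unfolding type_constraints_def
    by (cases "\<tau> t") (auto, metis not_one_le_zero)
  then show ?thesis
    using assms by (simp add: has_type_def)
qed

text \<open>
  A type constraint asks for a coordinate that is at least \<open>1\<close> rather than just positive. On the
  solution cone this is the same up to scaling, which is why vertex types pass the feasibility test.
\<close>

lemma feasible_if_has_type:
  fixes x :: "real^3^'t::finite"
  assumes "nonneg x" and "solves I M x" and ty: "has_type \<tau> x"
  obtains y where "nonneg y" and "solves I M y" and "type_constraints \<tau> y"
proof -
  define d :: "real^3^'t" where "d = (\<chi> t k. if x $ t $ k = 0 then 0 else 1)"
  have "\<And>t k. x $ t $ k = 0 \<Longrightarrow> d $ t $ k = 0"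
    by (simp add: d_def)
  then obtain c where c: "c > 0" "\<And>t k. \<bar>d $ t $ k\<bar> \<le> c * x $ t $ k"
    using support_le_imp_abs_le_scaled assms(1) by metis
  have "1 \<le> c * x $ t $ k" if "x $ t $ k \<noteq> 0" for t k
    using c(2)[of t k] that by (simp add: d_def)
  then have "type_constraints \<tau> (c *\<^sub>R x)"
    using ty unfolding type_constraints_def has_type_def
    by (metis dictated_zero.simps(2) mult_zero_right real_scaleR_def vector_scaleR_component)
  moreover have "nonneg (c *\<^sub>R x)" "solves I M (c *\<^sub>R x)"
    using assms c(1) by (simp_all add: nonneg_def solves_linear)
  ultimately show ?thesis
    using that by blast
qed

lemma vertex_types_antichain:
  assumes "\<tau> \<in> vertex_types I M" and "\<sigma> \<in> vertex_types I M" and "dominates \<tau> \<sigma>"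
  shows "\<sigma> = \<tau>"
proof -
  obtain x y where x: "x extreme_point_of projective_solution_space I M" "has_type \<tau> x"
    and y: "y extreme_point_of projective_solution_space I M" "has_type \<sigma> y"
    using assms by (auto simp: vertex_types_def)
  have "y = x"
    using x y assms(3)
    by (intro extreme_point_unique_on_support[OF x(1)])
       (auto simp: dominates_iff_support extreme_point_of_def projective_solution_space_iff)
  then show ?thesis
    using x y has_type_unique by blast
qed

lemma zero_not_vertex_type: "(\<lambda>t. Zero) \<notin> vertex_types I M"
  by (auto simp: vertex_types_def has_type_def extreme_point_of_def
      projective_solution_space_iff coord_sum_def)

lemma reconstruct_vertex:
  assumes x: "x extreme_point_of projective_solution_space I M" and ty: "has_type \<tau> x"
  shows "reconstruct I M \<tau> = x"
  unfolding reconstruct_def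
proof (rule the_equality)
  show "solves I M x \<and> coord_sum x = 1 \<and> (\<forall>t k. dictated_zero (\<tau> t) k \<longrightarrow> x $ t $ k = 0)"
    using x ty
    by (auto simp: has_type_def extreme_point_of_def projective_solution_space_iff)
next
  fix z
  assume "solves I M z \<and> coord_sum z = 1 \<and> (\<forall>t k. dictated_zero (\<tau> t) k \<longrightarrow> z $ t $ k = 0)"
  then show "z = x"
    using ty by (intro extreme_point_unique_on_support[OF x]) (auto simp: has_type_def)
qed

lemma reconstruct_image_vertex_types:
  "reconstruct I M ` vertex_types I M =
    {x. x extreme_point_of projective_solution_space I M \<and> admissible I M x}" (is "?L = ?R")
proof (intro equalityI subsetI)
  fix x
  assume "x \<in> ?L"
  then show "x \<in> ?R"
    by (auto simp: vertex_types_def reconstruct_vertex admissible_def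
        quad_constraints_iff_has_type extreme_point_of_def projective_solution_space_iff)
next
  fix x
  assume x: "x \<in> ?R"
  then obtain \<tau> where "has_type \<tau> x"
    by (auto simp: admissible_def quad_constraints_iff_has_type)
  with x have "\<tau> \<in> vertex_types I M" "reconstruct I M \<tau> = x"
    by (auto simp: vertex_types_def reconstruct_vertex)
  then show "x \<in> ?L"
    by blast
qed

text \<open>
  Scaling \<open>x\<close> to coordinate sum \<open>1\<close> gives a point of \<open>\<Q>\<close>. A vertex whose support lies in that of
  \<open>x\<close> inherits the quadrilateral constraints from \<open>x\<close>, so it is admissible.
\<close>

lemma feasible_dominates_vertex_type:
  fixes x :: "real^3^'t::finite"
  assumes "nonneg x" and "solves I M x" and ty: "has_type \<tau> x" and "\<tau> \<noteq> (\<lambda>t. Zero)"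
  obtains \<sigma> where "\<sigma> \<in> vertex_types I M" and "dominates \<tau> \<sigma>"
proof -
  have x0: "0 \<le> x $ t $ k" for t k
    using assms(1) by (simp add: nonneg_def)
  obtain t where "\<tau> t \<noteq> Zero"
    using assms(4) by auto
  then obtain j where "\<tau> t = Quad j"
    using ty by (cases "\<tau> t") (auto simp: has_type_def)
  then have "x $ t $ j \<noteq> 0"
    using ty unfolding has_type_def by (metis dictated_zero.simps(2))
  then have "0 < coord_sum x"
    unfolding coord_sum_def
    by (intro sum_pos2[of UNIV t] sum_pos2[of UNIV j] sum_nonneg) (auto simp: x0 order.strict_iff_order)
  then have "(1 / coord_sum x) *\<^sub>R x \<in> projective_solution_space I M"
    using assms x0 by (simp add: projective_solution_space_iff nonneg_def coord_sum_linear solves_linear)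
  then obtain y where y: "y extreme_point_of projective_solution_space I M"
    and "\<And>t k. ((1 / coord_sum x) *\<^sub>R x) $ t $ k = 0 \<Longrightarrow> y $ t $ k = 0"
    using extreme_point_in_support by blast
  then have supp: "\<And>t k. x $ t $ k = 0 \<Longrightarrow> y $ t $ k = 0"
    by simp
  have "card {j. y $ t $ j \<noteq> 0} \<le> card {j. x $ t $ j \<noteq> 0}" for t
    using supp by (intro card_mono) auto
  moreover have "quad_constraints x"
    using ty quad_constraints_iff_has_type by blast
  ultimately have "quad_constraints y"
    unfolding quad_constraints_def by (meson order_trans)
  then obtain \<sigma> where "has_type \<sigma> y"
    using quad_constraints_iff_has_type by blast
  then show ?thesis
    using that[of \<sigma>] y supp dominates_iff_support[OF ty] by (auto simp: vertex_types_def)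
qed


section \<open>Correctness of the traversal\<close>

definition completes :: "'t type_vector \<Rightarrow> 't type_vector \<Rightarrow> bool" where
  "completes \<sigma> \<tau> \<longleftrightarrow> (\<forall>t. \<tau> t \<noteq> Unknown \<longrightarrow> \<sigma> t = \<tau> t)"

text \<open>
  Nothing is asked at the unknown entries of \<open>\<tau>\<close>, because a completion of \<open>\<tau>\<close> can agree there with
  the complete type vector \<open>\<sigma>\<close>.
\<close>

definition completion_dominates :: "'t type_vector \<Rightarrow> 't type_vector \<Rightarrow> bool" where
  "completion_dominates \<tau> \<sigma> \<longleftrightarrow> (\<forall>t. \<tau> t \<noteq> Unknown \<longrightarrow> \<sigma> t = \<tau> t \<or> \<sigma> t = Zero)"

text \<open>
  A node above a vertex type \<open>\<sigma>\<close> can only fail the domination test. The \<open>\<rho> \<in> V\<close> responsible for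
  that is a vertex type dominated by \<open>\<sigma>\<close>, hence is \<open>\<sigma>\<close> itself.
\<close>

lemma rejected_child_has_no_new_vertex_type:
  assumes V: "V \<subseteq> vertex_types I M" and fail: "\<not> passes_tests I M V \<tau>"
    and \<sigma>: "\<sigma> \<in> vertex_types I M" and compl: "completes \<sigma> \<tau>"
  shows "\<sigma> \<in> V"
proof -
  obtain x where x: "x extreme_point_of projective_solution_space I M" "has_type \<sigma> x"
    using \<sigma> by (auto simp: vertex_types_def)
  then have "nonneg x" "solves I M x"
    by (auto simp: extreme_point_of_def projective_solution_space_iff)
  then obtain y where y: "nonneg y" "solves I M y" "type_constraints \<sigma> y"
    using feasible_if_has_type x(2) by blast
  have entry: "\<tau> t = Unknown \<or> \<tau> t = \<sigma> t" for t
    using compl by (auto simp: completes_def)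
  then have "type_constraints \<tau> y"
    using y(3) unfolding type_constraints_def
    by (metis dictated_zero.simps(3) type_entry.distinct(5))
  moreover have "\<tau> \<noteq> (\<lambda>t. Zero)"
    using entry \<sigma> zero_not_vertex_type by (metis ext type_entry.distinct(3))
  ultimately obtain \<rho> where \<rho>: "\<rho> \<in> V" "dominates (unknown_to_zero \<tau>) \<rho>"
    using fail y by (auto simp: passes_tests_def)
  have "dominates \<sigma> \<rho>"
    using \<rho>(2) entry unfolding dominates_def unknown_to_zero_def by metis
  then have "\<rho> = \<sigma>"
    using vertex_types_antichain V \<rho>(1) \<sigma> by blast
  with \<rho>(1) show ?thesis
    by simp
qed

lemma passing_leaf_is_vertex_type:
  assumes pass: "passes_tests I M V \<tau>" and leaf: "\<forall>t. \<tau> t \<noteq> Unknown"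
    and earlier: "\<And>\<sigma>. \<sigma> \<in> vertex_types I M \<Longrightarrow> dominates \<tau> \<sigma> \<Longrightarrow> \<sigma> \<noteq> \<tau> \<Longrightarrow> \<sigma> \<in> V"
  shows "\<tau> \<in> vertex_types I M"
proof -
  obtain x where "nonneg x" "solves I M x" "type_constraints \<tau> x" "\<tau> \<noteq> (\<lambda>t. Zero)"
    using pass by (auto simp: passes_tests_def)
  then obtain \<sigma> where \<sigma>: "\<sigma> \<in> vertex_types I M" "dominates \<tau> \<sigma>"
    using feasible_dominates_vertex_type type_constraints_imp_has_type leaf by metis
  moreover have "unknown_to_zero \<tau> = \<tau>"
    using leaf by (auto simp: unknown_to_zero_def)
  ultimately have "\<sigma> \<notin> V"
    using pass by (auto simp: passes_tests_def)
  with earlier \<sigma> show ?thesis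
    by blast
qed

definition sound_state ::
    "'e set \<Rightarrow> ('e \<Rightarrow> real^3^'t::finite) \<Rightarrow> 't type_vector set \<times> (real^3^'t) set \<Rightarrow> bool" where
  "sound_state I M s \<longleftrightarrow> fst s \<subseteq> vertex_types I M \<and> snd s = reconstruct I M ` fst s"

text \<open>
  These are the vertex types that can be dominated by a leaf below the node \<open>\<tau>\<close> without lying
  below \<open>\<tau>\<close> themselves. They branch off along an edge \<open>0\<close> on the path to \<open>\<tau>\<close>.
\<close>

definition earlier_types ::
    "'e set \<Rightarrow> ('e \<Rightarrow> real^3^'t::finite) \<Rightarrow> 't type_vector \<Rightarrow> 't type_vector set" where
  "earlier_types I M \<tau> =
     {\<sigma> \<in> vertex_types I M. completion_dominates \<tau> \<sigma> \<and> \<not> completes \<sigma> \<tau>}"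

text \<open>
  Processing a node adds all vertex types below it and nothing else, provided that the vertex
  types which its leaves might dominate are in \<open>V\<close> from the start. A child inherits this
  condition: for the edge \<open>0\<close> from its parent, and for the other edges because the child along the
  edge \<open>0\<close> has been dealt with. The tests are assumed for leaves only, since the root is never
  tested.
\<close>

lemma process_correct:
  fixes M :: "'e \<Rightarrow> real^3^'t::finite"
  assumes ord: "\<And>\<tau>. set (ord \<tau>) = {Quad 1, Quad 2, Quad 3}"
    and "distinct ts" and "{t. \<tau> t = Unknown} = set ts"
    and "ts = [] \<Longrightarrow> passes_tests I M (fst s) \<tau>"
    and "sound_state I M s" and "earlier_types I M \<tau> \<subseteq> fst s"
  defines "s' \<equiv> process I M ord ts \<tau> s"
  shows "sound_state I M s' \<and> fst s \<subseteq> fst s' \<and>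
    {\<sigma> \<in> vertex_types I M. completes \<sigma> \<tau>} \<subseteq> fst s'"
  unfolding s'_def
  using assms(2-6)
proof (induction ts arbitrary: \<tau> s)
  case Nil
  then have leaf: "\<forall>t. \<tau> t \<noteq> Unknown"
    by auto
  have "\<tau> \<in> vertex_types I M"
  proof (rule passing_leaf_is_vertex_type[OF _ leaf])
    show "passes_tests I M (fst s) \<tau>"
      using Nil by simp
    fix \<sigma>
    assume "\<sigma> \<in> vertex_types I M" "dominates \<tau> \<sigma>" "\<sigma> \<noteq> \<tau>"
    then have "\<sigma> \<in> earlier_types I M \<tau>"
      using leaf by (auto simp: earlier_types_def completion_dominates_def dominates_def completes_def)
    then show "\<sigma> \<in> fst s"
      using Nil by blast
  qed
  moreover have "\<sigma> = \<tau>" if "completes \<sigma> \<tau>" for \<sigma>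
    using that leaf by (auto simp: completes_def)
  ultimately show ?case
    using Nil by (auto simp: sound_state_def)
next
  case (Cons t ts)
  have \<tau>t: "\<tau> t = Unknown" and unk: "\<And>j. j \<noteq> Unknown \<Longrightarrow> {u. (\<tau>(t := j)) u = Unknown} = set ts"
    using Cons.prems(1,2) by (auto split: if_splits)
  define step where "step = (\<lambda>j s. if passes_tests I M (fst s) (\<tau>(t := j))
                 then process I M ord ts (\<tau>(t := j)) s else s)"
  have child: "sound_state I M (step j r) \<and> fst r \<subseteq> fst (step j r) \<and>
      {\<sigma> \<in> vertex_types I M. completes \<sigma> (\<tau>(t := j))} \<subseteq> fst (step j r)"
    if "j \<noteq> Unknown" "sound_state I M r" "earlier_types I M (\<tau>(t := j)) \<subseteq> fst r" for j r
  proof (cases "passes_tests I M (fst r) (\<tau>(t := j))")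
    case True
    then show ?thesis
      using Cons.IH[OF _ unk[OF that(1)] _ that(2,3)] Cons.prems(1)
      by (simp add: step_def del: fun_upd_apply)
  next
    case False
    then show ?thesis
      using rejected_child_has_no_new_vertex_type[OF _ False] that
      by (auto simp: step_def sound_state_def)
  qed
  have earlier: "earlier_types I M \<tau> \<subseteq> fst s"
    by (rule Cons.prems)
  have completes_child: "completes \<sigma> (\<tau>(t := j)) \<longleftrightarrow> completes \<sigma> \<tau> \<and> \<sigma> t = j"
    if "j \<noteq> Unknown" for \<sigma> j
    using that \<tau>t by (auto simp: completes_def)
  have earlier_zero: "earlier_types I M (\<tau>(t := Zero)) \<subseteq> earlier_types I M \<tau>"
    using \<tau>t by (auto simp: earlier_types_def completion_dominates_def completes_def split: if_splits)
  have earlier_quad: "earlier_types I M (\<tau>(t := Quad j)) \<subseteq>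
      earlier_types I M \<tau> \<union> {\<sigma> \<in> vertex_types I M. completes \<sigma> (\<tau>(t := Zero))}" for j
    using \<tau>t by (auto simp: earlier_types_def completion_dominates_def completes_def split: if_splits)
  define s0 where "s0 = step Zero s"
  have s0: "sound_state I M s0" "fst s \<subseteq> fst s0"
      "{\<sigma> \<in> vertex_types I M. completes \<sigma> (\<tau>(t := Zero))} \<subseteq> fst s0"
    using child[of Zero s] Cons.prems(4) earlier earlier_zero by (auto simp: s0_def)
  have "sound_state I M (fold step js r) \<and> fst r \<subseteq> fst (fold step js r) \<and>
      (\<forall>j\<in>set js. {\<sigma> \<in> vertex_types I M. completes \<sigma> (\<tau>(t := j))} \<subseteq> fst (fold step js r))"
    if "set js \<subseteq> range Quad" "sound_state I M r" "fst s0 \<subseteq> fst r" for js r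
    using that
  proof (induction js arbitrary: r)
    case Nil
    then show ?case by simp
  next
    case (Cons j js)
    obtain i where j: "j = Quad i"
      using Cons.prems(1) by auto
    have "earlier_types I M (\<tau>(t := j)) \<subseteq> fst r"
      using earlier_quad[of i] earlier s0(2,3) Cons.prems(3) unfolding j by blast
    then have *: "sound_state I M (step j r)" "fst r \<subseteq> fst (step j r)"
        "{\<sigma> \<in> vertex_types I M. completes \<sigma> (\<tau>(t := j))} \<subseteq> fst (step j r)"
      using child[of j r] Cons.prems(2) j by simp_all
    have "set js \<subseteq> range Quad" "fst s0 \<subseteq> fst (step j r)"
      using Cons.prems(1,3) *(2) by auto
    from Cons.IH[OF this(1) *(1) this(2)] *(2,3) show ?case
      by (simp del: fun_upd_apply) blast
  qed
  note loop = this
  have "Quad k \<in> set (ord \<tau>)" for k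
    using ord[of \<tau>] exhaust_3[of k] by auto
  with loop[OF _ s0(1) subset_refl, of "ord \<tau>"]
  have fin: "sound_state I M (fold step (ord \<tau>) s0)" "fst s0 \<subseteq> fst (fold step (ord \<tau>) s0)"
      "\<And>j. {\<sigma> \<in> vertex_types I M. completes \<sigma> (\<tau>(t := Quad j))} \<subseteq> fst (fold step (ord \<tau>) s0)"
    using ord[of \<tau>] by blast+
  have "\<sigma> \<in> fst (fold step (ord \<tau>) s0)"
    if \<sigma>: "\<sigma> \<in> vertex_types I M" "completes \<sigma> \<tau>" for \<sigma>
  proof (cases "\<sigma> t")
    case Zero
    then show ?thesis using \<sigma> s0(3) fin(2) by (auto simp: completes_child)
  next
    case (Quad j)
    then show ?thesis using \<sigma> fin(3)[of j] by (auto simp: completes_child)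
  next
    case Unknown
    then show ?thesis using \<sigma>(1) by (auto simp: vertex_types_def has_type_def)
  qed
  moreover have "process I M ord (t # ts) \<tau> s = fold step (ord \<tau>) s0"
    by (simp add: step_def s0_def)
  ultimately show ?case
    using fin s0(2) by auto
qed

lemma tree_traversal_correct:
  fixes M :: "'e \<Rightarrow> real^3^'t::finite"
  assumes "distinct ts" and "set ts = UNIV"
    and "\<And>\<tau>. set (ord \<tau>) = {Quad 1, Quad 2, Quad 3}"
  shows "tree_traversal I M ord ts =
    {x. x extreme_point_of projective_solution_space I M \<and> admissible I M x}"
proof -
  define s where "s = process I M ord ts (\<lambda>t. Unknown) ({}, {})"
  have "ts \<noteq> []"
    using assms(2) by auto
  moreover have "sound_state I M ({}, {})"
    by (simp add: sound_state_def)
  moreover have "earlier_types I M (\<lambda>t. Unknown) = {}"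
    by (simp add: earlier_types_def completes_def)
  ultimately have "sound_state I M s \<and> {\<sigma> \<in> vertex_types I M. completes \<sigma> (\<lambda>t. Unknown)} \<subseteq> fst s"
    unfolding s_def
    using process_correct[OF assms(3,1), of "\<lambda>t. Unknown" I M "({}, {})"] assms(2) by simp
  then have "snd s = reconstruct I M ` fst s" and "fst s = vertex_types I M"
    by (auto simp: sound_state_def completes_def)
  then have "snd s = reconstruct I M ` vertex_types I M"
    by simp
  then show ?thesis
    unfolding tree_traversal_def s_def[symmetric] reconstruct_image_vertex_types[symmetric] .
qed

lemma solves_iff_orthogonal_span: "solves I M x \<longleftrightarrow> (\<forall>v\<in>span (M ` I). v \<bullet> x = 0)"
proof
  assume "solves I M x"
  then have "\<And>v. v \<in> M ` I \<Longrightarrow> orthogonal x v"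
    by (auto simp: solves_def orthogonal_def inner_commute)
  then show "\<forall>v\<in>span (M ` I). v \<bullet> x = 0"
    by (metis orthogonal_def orthogonal_to_span inner_commute)
qed (auto simp: solves_def span_base)

lemma solves_full_rank_rows:
  assumes "full_rank_rows I M K"
  shows "solves K M = solves I M"
  using assms by (auto simp: full_rank_rows_def solves_iff_orthogonal_span)

theorem theorem3p11:
  fixes G :: "'t::finite gluing"
    and tets :: "'t list"
    and quad :: "'t \<Rightarrow> 4 set set \<Rightarrow> 3"
    and start :: "('t \<times> 4 set) set \<Rightarrow> 't corner"
    and M :: "('t \<times> 4 set) set \<Rightarrow> real^3^'t"
    and K :: "('t \<times> 4 set) set set"
    and ord :: "'t type_vector \<Rightarrow> type_entry list"
  assumes "three_manifold_triangulation G"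
    and "distinct tets" and "set tets = UNIV"
    and "\<forall>t. bij_betw (quad t) quad_types UNIV"
    and "\<forall>E \<in> interior_edges G. is_corner_of (start E) E"
    and "M = matching_matrix G quad start"
    and "full_rank_rows (interior_edges G) M K"
    and "\<forall>\<tau>. distinct (ord \<tau>) \<and> set (ord \<tau>) = {Quad 1, Quad 2, Quad 3}"
  shows "tree_traversal K M ord tets =
    {x. x extreme_point_of projective_solution_space (interior_edges G) M \<and>
        admissible (interior_edges G) M x}"
proof -
  have "tree_traversal K M ord tets =
      {x. x extreme_point_of projective_solution_space K M \<and> admissible K M x}"
    using assms by (intro tree_traversal_correct) simp_all
  then show ?thesis
    using solves_full_rank_rows[OF assms(7)]
    by (simp add: projective_solution_space_def solution_cone_def admissible_def)
qed

end
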